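(* Consider a two-armed sequential experiment with arms $k\in\{0,1\}$ run for steps $t=0,1,2,\dots$, with $n\ge 1$ participants per step. Rewards are independent with $Y_{t,i}(A_{t,i}=k)\sim\mathcal N(\mu_k,\sigma_y^2)$, $\sigma_y^2>0$ known, and arms are allocated by standard (unrestricted) Thompson Sampling with identical independent priors $\mu_0,\mu_1\sim\mathcal N(\mu_{\text{prior}},\sigma^2_{\text{prior}})$, so that the allocation probability of arm $1$ at step $t$ is $$\pi^{\text{TS}}_{t,1}=\mathbb P(\tilde\mu_{t,1}>\tilde\mu_{t,0}\mid\mathcal H_{t-1})=\Phi\!\left(\frac{\mu_{D_t}}{\sigma_{D_t}}\right),$$ with $\mu_{D_t},\sigma_{D_t}$ as defined in the context. Define the Allocation Probability test statistic $$\mathrm{AP}^{\text{TS}}_T=\sum_{t=1}^{T}\mathbb I\big(\pi^{\text{TS}}_{t,1}>0.5\big).$$ If $\mu_1>\mu_0$, then $\mathrm{AP}^{\text{TS}}_T$ diverges as $T\to\infty$, i.e. $\mathrm{AP}^{\text{TS}}_T\to\infty$.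
   Context: $A_{t,i}\in\{0,1\}$ is the arm assigned to participant $i$ at step $t$; $\mathcal H_{t-1}$ is the history of arms and rewards observed at steps before $t$. Thompson Sampling: at each step a sample $(\tilde\mu_{t,0},\tilde\mu_{t,1})$ is drawn from the current posterior (the prior at $t=0$) and the arm with the larger sampled mean is allocated. With $N_{t,k}$ the number of allocations of arm $k$ before step $t$ and $S_{t,k}=\sum_{\tau<t}\sum_{i=1}^n Y_{\tau,i}\mathbb I(A_{\tau,i}=k)$, $$\mu_{D_t}=\frac{\sigma_y^2\mu_{\text{prior}}+\sigma^2_{\text{prior}}S_{t,1}}{\sigma_y^2+N_{t,1}\sigma^2_{\text{prior}}}-\frac{\sigma_y^2\mu_{\text{prior}}+\sigma^2_{\text{prior}}S_{t,0}}{\sigma_y^2+N_{t,0}\sigma^2_{\text{prior}}},\qquad \sigma^2_{D_t}=\frac{\sigma^2_{\text{prior}}\sigma^2_y}{\sigma_y^2+N_{t,1}\sigma^2_{\text{prior}}}+\frac{\sigma^2_{\text{prior}}\sigma^2_y}{\sigma_y^2+N_{t,0}\sigma^2_{\text{prior}}},$$ these being the mean and variance of the posterior distribution of $\mu_1-\mu_0$ given $\mathcal H_{t-1}$. $\Phi$ is the standard normal CDF and $\mathbb I$ the indicator function. *)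

theory Defs
  imports "HOL-Probability.Probability"
begin

definition Phi :: "real \<Rightarrow> real" where
  "Phi x = cdf (density lborel std_normal_density) x"

text \<open>Posterior mean and variance of one arm's mean, given N allocations with reward sum S,
  under prior N(mp, sp2) and known reward variance sy2.\<close>
definition post_mean :: "real \<Rightarrow> real \<Rightarrow> real \<Rightarrow> real \<Rightarrow> real \<Rightarrow> real" where
  "post_mean sy2 mp sp2 N S = (sy2 * mp + sp2 * S) / (sy2 + N * sp2)"

definition post_var :: "real \<Rightarrow> real \<Rightarrow> real \<Rightarrow> real" where
  "post_var sy2 sp2 N = sp2 * sy2 / (sy2 + N * sp2)"

text \<open>Thompson Sampling choice for participant i at step t, given the history statistics
  st = (N0, N1, S0, S1): draw a posterior sample for each arm (using the standard normal
  noise Z t i k) and allocate arm 1 (True) iff its sampled mean is larger.\<close>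
definition ts_choice ::
  "real \<Rightarrow> real \<Rightarrow> real \<Rightarrow> (nat \<Rightarrow> nat \<Rightarrow> nat \<Rightarrow> 'a \<Rightarrow> real) \<Rightarrow> nat \<Rightarrow> nat \<Rightarrow> 'a
    \<Rightarrow> real \<times> real \<times> real \<times> real \<Rightarrow> bool" where
  "ts_choice sy2 mp sp2 Z t i \<omega> st = (case st of (N0, N1, S0, S1) \<Rightarrow>
     post_mean sy2 mp sp2 N1 S1 + sqrt (post_var sy2 sp2 N1) * Z t i 1 \<omega>
       > post_mean sy2 mp sp2 N0 S0 + sqrt (post_var sy2 sp2 N0) * Z t i 0 \<omega>)"

text \<open>History statistics (N_{t,0}, N_{t,1}, S_{t,0}, S_{t,1}) before step t.
  Y t i k is the potential reward of participant i at step t under arm k.\<close>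
primrec ts_stats ::
  "nat \<Rightarrow> real \<Rightarrow> real \<Rightarrow> real \<Rightarrow> (nat \<Rightarrow> nat \<Rightarrow> nat \<Rightarrow> 'a \<Rightarrow> real)
    \<Rightarrow> (nat \<Rightarrow> nat \<Rightarrow> nat \<Rightarrow> 'a \<Rightarrow> real) \<Rightarrow> nat \<Rightarrow> 'a \<Rightarrow> real \<times> real \<times> real \<times> real" where
  "ts_stats n sy2 mp sp2 Y Z 0 \<omega> = (0, 0, 0, 0)"
| "ts_stats n sy2 mp sp2 Y Z (Suc t) \<omega> =
     (case ts_stats n sy2 mp sp2 Y Z t \<omega> of (N0, N1, S0, S1) \<Rightarrow>
       let A = (\<lambda>i. ts_choice sy2 mp sp2 Z t i \<omega> (N0, N1, S0, S1)) in
       (N0 + real (card {i. i < n \<and> \<not> A i}),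
        N1 + real (card {i. i < n \<and> A i}),
        S0 + (\<Sum>i\<in>{i. i < n \<and> \<not> A i}. Y t i 0 \<omega>),
        S1 + (\<Sum>i\<in>{i. i < n \<and> A i}. Y t i 1 \<omega>)))"

definition ts_alloc where
  "ts_alloc n sy2 mp sp2 Y Z t i \<omega> = ts_choice sy2 mp sp2 Z t i \<omega> (ts_stats n sy2 mp sp2 Y Z t \<omega>)"

definition mu_D where
  "mu_D n sy2 mp sp2 Y Z t \<omega> = (case ts_stats n sy2 mp sp2 Y Z t \<omega> of (N0, N1, S0, S1) \<Rightarrow>
     post_mean sy2 mp sp2 N1 S1 - post_mean sy2 mp sp2 N0 S0)"

definition sigma2_D where
  "sigma2_D n sy2 mp sp2 Y Z t \<omega> = (case ts_stats n sy2 mp sp2 Y Z t \<omega> of (N0, N1, S0, S1) \<Rightarrow>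
     post_var sy2 sp2 N1 + post_var sy2 sp2 N0)"

definition pi_TS where
  "pi_TS n sy2 mp sp2 Y Z t \<omega> =
     Phi (mu_D n sy2 mp sp2 Y Z t \<omega> / sqrt (sigma2_D n sy2 mp sp2 Y Z t \<omega>))"

definition AP_TS where
  "AP_TS n sy2 mp sp2 Y Z T \<omega> = card {t \<in> {1..T}. pi_TS n sy2 mp sp2 Y Z t \<omega> > 1/2}"

definition ts_index :: "nat \<Rightarrow> (nat \<times> nat \<times> nat) set" where
  "ts_index n = {(t, i, k). i < n \<and> k < 2}"

end

theory Submission
  imports Defs
begin

text \<open>
  If both arms are pulled infinitely often, the posterior means converge almost surely to the true
  means, so \<open>mu_D\<close> is eventually positive and the allocation probability eventually exceeds 1/2.

  Convergence of the posterior means is a law of large numbers for adaptively chosen observations.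
  For centred Gaussian noise with variance \<open>s\<^sup>2\<close>, the process
  \<open>exp (l * S\<^sub>j - l\<^sup>2 * s\<^sup>2 / 2 * N\<^sub>j)\<close> has mean 1, where \<open>S\<^sub>j\<close> is the sum of the
  \<open>N\<^sub>j\<close> noise terms observed so far. Stopping it after \<open>m\<close> observations and taking
  \<open>l = e / s\<^sup>2\<close>, Markov's inequality bounds the probability of a deviation \<open>S \<ge> e * m\<close> by
  \<open>exp (- e\<^sup>2 * m / (2 * s\<^sup>2))\<close>, which is summable in \<open>m\<close>.

  An arm pulled only finitely often would have a constant posterior of positive variance, while the
  posterior mean of the other arm stays bounded. Almost surely the sampling noise of the first arm is
  arbitrarily large while that of the other is negative infinitely often, which forces another pull.
\<close>

lemma emeasure_normal_density_pos:
  assumes "s > 0" "A \<in> sets borel" "emeasure lborel A > 0"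
  shows "emeasure (density lborel (normal_density m s)) A > 0"
proof (rule ccontr)
  assume "\<not> ?thesis"
  then have "A \<in> null_sets (density lborel (normal_density m s))"
    using assms by (auto simp: null_sets_def)
  then have "AE x in lborel. x \<in> A \<longrightarrow> ennreal (normal_density m s x) = 0"
    by (subst (asm) null_sets_density_iff) auto
  then have "AE x in lborel. x \<notin> A"
    by eventually_elim (use normal_density_pos[OF assms(1), of m] in \<open>auto simp: ennreal_eq_0_iff not_le[symmetric]\<close>)
  then have "A \<in> null_sets lborel"
    using assms by (subst AE_iff_null_sets) auto
  with assms(3) show False by (auto simp: null_sets_def)
qed

lemma Phi_gt_half:
  assumes "x > 0"
  shows "Phi x > 1/2"
proof -
  define D where "D = density lborel std_normal_density"
  interpret D: prob_space D
    unfolding D_def by (rule prob_space_normal_density) simp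
  have sets [simp]: "sets D = sets borel" "space D = UNIV"
    by (auto simp: D_def)
  have "D.prob {x<..} = D.prob {..<-x}"
  proof -
    have "emeasure D {x<..} = (\<integral>\<^sup>+ y. ennreal (std_normal_density y) * indicator {x<..} y \<partial>lborel)"
      by (simp add: D_def emeasure_density)
    also have "\<dots> = (\<integral>\<^sup>+ y. ennreal (std_normal_density (-y)) * indicator {x<..} (-y) \<partial>lborel)"
      by (subst nn_integral_real_affine[where c = "-1" and t = 0]) auto
    also have "\<dots> = (\<integral>\<^sup>+ y. ennreal (std_normal_density y) * indicator {..<-x} y \<partial>lborel)"
      by (intro nn_integral_cong) (auto simp: std_normal_density_def indicator_def)
    also have "\<dots> = emeasure D {..<-x}"
      by (simp add: D_def emeasure_density)
    finally show ?thesis by (simp add: measure_def)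
  qed
  moreover have "D.prob {..x} + D.prob {x<..} = 1"
    using D.prob_compl[of "{..x}"] by (auto simp: Compl_eq_Diff_UNIV[symmetric])
  moreover have "D.prob {..x} = D.prob {..<-x} + D.prob {-x..x}"
  proof -
    have "{..x} = {..<-x} \<union> {-x..x}" using assms by auto
    moreover have "D.prob ({..<-x} \<union> {-x..x}) = D.prob {..<-x} + D.prob {-x..x}"
      by (rule D.finite_measure_Union) auto
    ultimately show ?thesis by metis
  qed
  moreover have "D.prob {-x..x} > 0"
    using emeasure_normal_density_pos[of 1 "{-x..x}" 0] assms
    by (simp add: D_def[symmetric] D.emeasure_eq_measure)
  ultimately show ?thesis
    by (simp add: Phi_def cdf_def D_def)
qed

lemma (in prob_space) AE_infinite_indep_events:
  assumes ind: "indep_events (\<lambda>t. {x \<in> space M. P t x}) (UNIV :: nat set)"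
    and p: "p > 0" "\<And>t. prob {x \<in> space M. P t x} \<ge> p"
  shows "AE x in M. infinite {t. P t x}"
proof -
  have meas: "{x \<in> space M. P t x} \<in> sets M" for t
    using ind by (auto simp: indep_events_def)
  have "(AE x in M. infinite {t. P t x}) \<or> (AE x in M. finite {t. P t x})"
    by (rule borel_0_1_law_AE[OF ind])
  moreover have False if fin: "AE x in M. finite {t. P t x}"
  proof -
    have "(\<lambda>t. \<integral>x. indicat_real {x \<in> space M. P t x} x \<partial>M) \<longlonglongrightarrow> (\<integral>x. 0 \<partial>M)"
    proof (rule integral_dominated_convergence[where w = "\<lambda>_. 1"])
      show "AE x in M. (\<lambda>t. indicat_real {x \<in> space M. P t x} x) \<longlonglongrightarrow> 0"
        using fin
      proof eventually_elim
        fix x assume "finite {t. P t x}"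
        then have "eventually (\<lambda>t. \<not> P t x) sequentially"
          by (simp add: cofinite_eq_sequentially[symmetric] eventually_cofinite)
        then have "eventually (\<lambda>t. indicat_real {x \<in> space M. P t x} x = 0) sequentially"
          by eventually_elim auto
        then show "(\<lambda>t. indicat_real {x \<in> space M. P t x} x) \<longlonglongrightarrow> 0"
          by (rule tendsto_eventually)
      qed
    qed (use meas in \<open>auto simp: indicator_def\<close>)
    then have "(\<lambda>t. prob {x \<in> space M. P t x}) \<longlonglongrightarrow> 0"
      using meas by (simp add: Int_absorb2[OF sets.sets_into_space])
    then have "p \<le> 0"
      using p(2) by (intro LIMSEQ_le_const) auto
    with p(1) show False by simp
  qed
  ultimately show ?thesis by blast
qed

lemma (in prob_space) indep_var_nn_integral_mult:
  fixes X Y :: "'a \<Rightarrow> real"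
  assumes "indep_var borel X borel Y"
  shows "(\<integral>\<^sup>+\<omega>. ennreal (X \<omega>) * ennreal (Y \<omega>) \<partial>M)
       = (\<integral>\<^sup>+\<omega>. ennreal (X \<omega>) \<partial>M) * (\<integral>\<^sup>+\<omega>. ennreal (Y \<omega>) \<partial>M)"
proof -
  have "indep_var borel (ennreal \<circ> X) borel (ennreal \<circ> Y)"
    by (rule indep_var_compose[OF assms]) auto
  moreover have "case_bool borel borel = (\<lambda>_. borel :: ennreal measure)"
    by (auto split: bool.split)
  ultimately have "indep_vars (\<lambda>_. borel) (case_bool (ennreal \<circ> X) (ennreal \<circ> Y)) UNIV"
    by (simp add: indep_var_def)
  from indep_vars_nn_integral[OF _ this] show ?thesis
    by (simp add: UNIV_bool mult.commute comp_def)
qed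

lemma (in prob_space) nn_integral_exp_normal:
  assumes "distributed M lborel X (normal_density 0 s)" "s > 0"
  shows "(\<integral>\<^sup>+\<omega>. ennreal (exp (l * X \<omega> - l\<^sup>2 * s\<^sup>2 / 2)) \<partial>M) = 1"
proof -
  have "(\<integral>\<^sup>+\<omega>. ennreal (exp (l * X \<omega> - l\<^sup>2 * s\<^sup>2 / 2)) \<partial>M)
      = (\<integral>\<^sup>+x. ennreal (normal_density 0 s x) * ennreal (exp (l * x - l\<^sup>2 * s\<^sup>2 / 2)) \<partial>lborel)"
    by (rule distributed_nn_integral[OF assms(1), symmetric]) auto
  also have "\<dots> = (\<integral>\<^sup>+x. ennreal (normal_density (l * s\<^sup>2) s x) \<partial>lborel)"
  proof (rule nn_integral_cong)
    fix x :: real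
    have "- x\<^sup>2 / (2 * s\<^sup>2) + (l * x - l\<^sup>2 * s\<^sup>2 / 2) = - (x - l * s\<^sup>2)\<^sup>2 / (2 * s\<^sup>2)"
      using assms(2) by (simp add: field_simps power2_eq_square)
    then have "exp (- x\<^sup>2 / (2 * s\<^sup>2)) * exp (l * x - l\<^sup>2 * s\<^sup>2 / 2) = exp (- (x - l * s\<^sup>2)\<^sup>2 / (2 * s\<^sup>2))"
      by (metis exp_add)
    then have "normal_density 0 s x * exp (l * x - l\<^sup>2 * s\<^sup>2 / 2) = normal_density (l * s\<^sup>2) s x"
      by (simp add: normal_density_def)
    then show "ennreal (normal_density 0 s x) * ennreal (exp (l * x - l\<^sup>2 * s\<^sup>2 / 2))
        = ennreal (normal_density (l * s\<^sup>2) s x)"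
      by (simp add: ennreal_mult[symmetric])
  qed
  also have "\<dots> = 1"
    using prob_space.emeasure_space_1[OF prob_space_normal_density[OF assms(2)], of "l * s\<^sup>2"]
    by (simp add: emeasure_density)
  finally show ?thesis .
qed

subsection \<open>A law of large numbers under adaptive sampling\<close>

definition pulls :: "(nat \<Rightarrow> 'a \<Rightarrow> bool) \<Rightarrow> nat \<Rightarrow> 'a \<Rightarrow> nat" where
  "pulls b j \<omega> = (\<Sum>i<j. of_bool (b i \<omega>))"

text \<open>Stopping after \<open>m\<close> pulls makes the deviation events of \<open>capped_deviation_bound\<close> increasing
  in time, so that a bound that is uniform in time controls their union without any maximal inequality.\<close>

definition capped :: "(nat \<Rightarrow> 'a \<Rightarrow> bool) \<Rightarrow> nat \<Rightarrow> nat \<Rightarrow> 'a \<Rightarrow> bool" where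
  "capped b m i \<omega> \<longleftrightarrow> b i \<omega> \<and> pulls b i \<omega> < m"

lemma pulls_mono: "i \<le> j \<Longrightarrow> pulls b i \<omega> \<le> pulls b j \<omega>"
  unfolding pulls_def by (intro sum_mono2) auto

lemma pulls_capped: "pulls (capped b m) j \<omega> = min (pulls b j \<omega>) m"
  by (induction j) (auto simp: pulls_def capped_def)

locale gaussian_noise = prob_space M for M :: "'a measure" +
  fixes F :: "nat \<Rightarrow> 'a measure" and X :: "nat \<Rightarrow> 'a \<Rightarrow> real" and s :: real
  assumes s_pos: "s > 0"
    and adapted: "\<And>i j. i < j \<Longrightarrow> X i \<in> borel_measurable (F j)"
    and indep_past: "\<And>j f. f \<in> borel_measurable (F j) \<Longrightarrow> indep_var borel f borel (X j)"
    and normal: "\<And>j. distributed M lborel (X j) (normal_density 0 s)"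
begin

lemma X_measurable [measurable]: "X j \<in> borel_measurable M"
  using distributed_measurable[OF normal[of j]] by simp

lemma past_measurable: "f \<in> borel_measurable (F j) \<Longrightarrow> f \<in> borel_measurable M" for f :: "'a \<Rightarrow> real"
  using indep_past[of f j] by (simp add: indep_var_rv1)

lemma past_pred_measurable:
  assumes "Measurable.pred (F j) P"
  shows "Measurable.pred M P"
proof -
  have "(\<lambda>\<omega>. of_bool (P \<omega>) :: real) \<in> borel_measurable (F j)"
    using assms by measurable
  then have [measurable]: "(\<lambda>\<omega>. of_bool (P \<omega>) :: real) \<in> borel_measurable M"
    by (rule past_measurable)
  have "Measurable.pred M (\<lambda>\<omega>. of_bool (P \<omega>) = (1 :: real))"
    by measurable
  then show ?thesis by simp
qed

definition noise_sum :: "(nat \<Rightarrow> 'a \<Rightarrow> bool) \<Rightarrow> nat \<Rightarrow> 'a \<Rightarrow> real" where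
  "noise_sum b j \<omega> = (\<Sum>i<j. of_bool (b i \<omega>) * X i \<omega>)"

lemma nn_integral_exp_noise_sum:
  assumes b: "\<And>i j. i \<le> j \<Longrightarrow> Measurable.pred (F j) (b i)"
  shows "(\<integral>\<^sup>+\<omega>. ennreal (exp (l * noise_sum b j \<omega> - l\<^sup>2 * s\<^sup>2 / 2 * real (pulls b j \<omega>))) \<partial>M) = 1"
proof (induction j)
  case 0
  then show ?case by (simp add: noise_sum_def pulls_def emeasure_space_1)
next
  case (Suc j)
  let ?c = "l\<^sup>2 * s\<^sup>2 / 2"
  define P where "P \<omega> = exp (l * noise_sum b j \<omega> - ?c * real (pulls b j \<omega>))" for \<omega>
  define V where "V \<omega> = exp (l * X j \<omega> - ?c)" for \<omega>
  have bF [measurable]: "i \<le> j \<Longrightarrow> Measurable.pred (F j) (b i)" for i by (rule b)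
  have XF [measurable]: "i < j \<Longrightarrow> X i \<in> borel_measurable (F j)" for i by (rule adapted)
  have [measurable]: "P \<in> borel_measurable (F j)"
    unfolding P_def noise_sum_def pulls_def by measurable
  have PM [measurable]: "P \<in> borel_measurable M" by (rule past_measurable) fact
  have [measurable]: "Measurable.pred M (b j)" by (rule past_pred_measurable[where j = j]) simp
  have [measurable]: "V \<in> borel_measurable M" unfolding V_def by measurable
  have [simp]: "0 \<le> P \<omega>" "0 \<le> V \<omega>" for \<omega> by (auto simp: P_def V_def)
  have ind: "indep_var borel (\<lambda>\<omega>. P \<omega> * of_bool (b j \<omega>)) borel V"
  proof -
    have "indep_var borel (\<lambda>\<omega>. P \<omega> * of_bool (b j \<omega>)) borel (X j)"
      by (rule indep_past) (use bF[of j] in measurable)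
    from indep_var_compose[OF this, of id borel "\<lambda>x. exp (l * x - ?c)" borel]
    show ?thesis by (simp add: comp_def V_def[abs_def])
  qed
  have V1: "(\<integral>\<^sup>+\<omega>. ennreal (V \<omega>) \<partial>M) = 1"
    unfolding V_def by (rule nn_integral_exp_normal[OF normal s_pos])
  have step: "exp (l * noise_sum b (Suc j) \<omega> - ?c * real (pulls b (Suc j) \<omega>))
      = P \<omega> * of_bool (b j \<omega>) * V \<omega> + P \<omega> * of_bool (\<not> b j \<omega>)" for \<omega>
    by (auto simp: noise_sum_def pulls_def P_def V_def exp_add[symmetric] algebra_simps)
  have "(\<integral>\<^sup>+\<omega>. ennreal (exp (l * noise_sum b (Suc j) \<omega> - ?c * real (pulls b (Suc j) \<omega>))) \<partial>M)
      = (\<integral>\<^sup>+\<omega>. ennreal (P \<omega> * of_bool (b j \<omega>)) * ennreal (V \<omega>) + ennreal (P \<omega> * of_bool (\<not> b j \<omega>)) \<partial>M)"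
    unfolding step by (intro nn_integral_cong) (simp add: ennreal_mult)
  also have "\<dots> = (\<integral>\<^sup>+\<omega>. ennreal (P \<omega> * of_bool (b j \<omega>)) * ennreal (V \<omega>) \<partial>M)
      + (\<integral>\<^sup>+\<omega>. ennreal (P \<omega> * of_bool (\<not> b j \<omega>)) \<partial>M)"
    by (rule nn_integral_add) measurable
  also have "\<dots> = (\<integral>\<^sup>+\<omega>. ennreal (P \<omega> * of_bool (b j \<omega>)) \<partial>M) + (\<integral>\<^sup>+\<omega>. ennreal (P \<omega> * of_bool (\<not> b j \<omega>)) \<partial>M)"
    by (simp add: indep_var_nn_integral_mult[OF ind] V1)
  also have "\<dots> = (\<integral>\<^sup>+\<omega>. ennreal (P \<omega> * of_bool (b j \<omega>)) + ennreal (P \<omega> * of_bool (\<not> b j \<omega>)) \<partial>M)"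
    by (rule nn_integral_add[symmetric]) measurable
  also have "\<dots> = (\<integral>\<^sup>+\<omega>. ennreal (P \<omega>) \<partial>M)"
    by (intro nn_integral_cong) auto
  also have "\<dots> = 1" using Suc unfolding P_def .
  finally show ?case .
qed

lemma noise_sum_capped:
  assumes "pulls b j \<omega> \<le> m"
  shows "noise_sum (capped b m) j \<omega> = noise_sum b j \<omega>"
proof -
  have "capped b m i \<omega> = b i \<omega>" if "i < j" for i
  proof (cases "b i \<omega>")
    case True
    have "pulls b (Suc i) \<omega> \<le> pulls b j \<omega>" using that by (intro pulls_mono) auto
    with True assms show ?thesis by (simp add: pulls_def capped_def)
  qed (simp add: capped_def)
  then show ?thesis by (simp add: noise_sum_def)
qed

lemma capped_deviation_bound:
  fixes e :: real
  assumes b: "\<And>i j. i \<le> j \<Longrightarrow> Measurable.pred (F j) (b i)" and e: "e > 0"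
  shows "emeasure M {\<omega> \<in> space M. pulls b j \<omega> \<ge> m \<and> noise_sum (capped b m) j \<omega> \<ge> e * m}
       \<le> ennreal (exp (- e\<^sup>2 / (2 * s\<^sup>2)) ^ m)" (is "emeasure M ?E \<le> _")
proof -
  define l where "l = e / s\<^sup>2"
  have l: "l > 0" using e s_pos by (simp add: l_def)
  have c: "Measurable.pred (F j) (capped b m i)" if "i \<le> j" for i j
  proof -
    have [measurable]: "i' \<le> i \<Longrightarrow> Measurable.pred (F j) (b i')" for i'
      using that by (intro b) auto
    show ?thesis unfolding capped_def pulls_def by measurable
  qed
  have [measurable]: "Measurable.pred M (b i)" "Measurable.pred M (capped b m i)" for i
    using past_pred_measurable b c by blast+
  have [measurable]: "?E \<in> sets M"
    unfolding pulls_def noise_sum_def by measurable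
  define B where "B = exp (e\<^sup>2 / (2 * s\<^sup>2)) ^ m"
  let ?L = "\<lambda>\<omega>. exp (l * noise_sum (capped b m) j \<omega> - l\<^sup>2 * s\<^sup>2 / 2 * real (pulls (capped b m) j \<omega>))"
  have "B \<le> ?L \<omega>" if "\<omega> \<in> ?E" for \<omega>
  proof -
    have "l * (e * m) \<le> l * noise_sum (capped b m) j \<omega>"
      using that l by (intro mult_left_mono) auto
    moreover have "real m * (e\<^sup>2 / (2 * s\<^sup>2)) = l * (e * m) - l\<^sup>2 * s\<^sup>2 / 2 * m"
      using s_pos by (simp add: l_def field_simps power2_eq_square)
    ultimately have "real m * (e\<^sup>2 / (2 * s\<^sup>2)) \<le> l * noise_sum (capped b m) j \<omega> - l\<^sup>2 * s\<^sup>2 / 2 * m"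
      by linarith
    then show ?thesis
      using that by (simp add: B_def exp_of_nat_mult[symmetric] pulls_capped min_absorb2)
  qed
  then have "(\<integral>\<^sup>+\<omega>. ennreal B * indicator ?E \<omega> \<partial>M) \<le> (\<integral>\<^sup>+\<omega>. ennreal (?L \<omega>) \<partial>M)"
    by (intro nn_integral_mono) (auto simp: indicator_def intro!: ennreal_leI)
  also have "\<dots> = 1" by (rule nn_integral_exp_noise_sum[OF c])
  finally have "ennreal B * emeasure M ?E \<le> 1"
    by (simp add: nn_integral_cmult_indicator)
  then have "B * prob ?E \<le> 1"
    by (simp add: emeasure_eq_measure ennreal_mult[symmetric] B_def)
  moreover have "exp (- e\<^sup>2 / (2 * s\<^sup>2)) ^ m = 1 / B"
    by (simp add: B_def exp_minus power_one_over inverse_eq_divide)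
  moreover have "B > 0" by (simp add: B_def)
  ultimately have "prob ?E \<le> exp (- e\<^sup>2 / (2 * s\<^sup>2)) ^ m"
    by (simp add: pos_le_divide_eq mult.commute)
  then show ?thesis by (simp add: emeasure_eq_measure)
qed

lemma AE_noise_sum_less:
  fixes e :: real
  assumes b: "\<And>i j. i \<le> j \<Longrightarrow> Measurable.pred (F j) (b i)" and e: "e > 0"
  shows "AE \<omega> in M. eventually (\<lambda>m. \<forall>j. pulls b j \<omega> = m \<longrightarrow> noise_sum b j \<omega> < e * m) sequentially"
proof -
  let ?E = "\<lambda>m j. {\<omega> \<in> space M. pulls b j \<omega> \<ge> m \<and> noise_sum (capped b m) j \<omega> \<ge> e * m}"
  let ?q = "exp (- e\<^sup>2 / (2 * s\<^sup>2))"
  have [measurable]: "Measurable.pred M (b i)" for i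
    using past_pred_measurable b by blast
  have [measurable]: "?E m j \<in> sets M" for m j
    unfolding capped_def pulls_def noise_sum_def by measurable
  have inc: "incseq (?E m)" for m
  proof (rule incseq_SucI, safe)
    fix j \<omega> assume "m \<le> pulls b j \<omega>" "e * m \<le> noise_sum (capped b m) j \<omega>"
    moreover from this have "\<not> capped b m j \<omega>" by (simp add: capped_def)
    ultimately show "m \<le> pulls b (Suc j) \<omega>" "e * m \<le> noise_sum (capped b m) (Suc j) \<omega>"
      by (auto simp: pulls_def noise_sum_def)
  qed
  have "emeasure M (\<Union>j. ?E m j) \<le> ennreal (?q ^ m)" for m
  proof -
    have "emeasure M (\<Union>j. ?E m j) = (SUP j. emeasure M (?E m j))"
      by (rule SUP_emeasure_incseq[symmetric]) (use inc in auto)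
    also have "\<dots> \<le> ennreal (?q ^ m)"
      by (intro SUP_least capped_deviation_bound b e)
    finally show ?thesis .
  qed
  then have bound: "prob (\<Union>j. ?E m j) \<le> ?q ^ m" for m
    by (simp add: emeasure_eq_measure)
  have "summable (\<lambda>m. ?q ^ m)"
    using e s_pos by (intro summable_geometric) auto
  then have "summable (\<lambda>m. prob (\<Union>j. ?E m j))"
    by (rule summable_comparison_test'[where N = 0])
      (simp only: real_norm_def abs_of_nonneg[OF measure_nonneg] bound)
  then have "AE \<omega> in M. eventually (\<lambda>m. \<omega> \<in> space M - (\<Union>j. ?E m j)) sequentially"
    by (intro borel_cantelli_AE1) (auto simp: emeasure_eq_measure)
  then show ?thesis
  proof eventually_elim
    case (elim \<omega>)
    then show ?case
    proof eventually_elim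
      case (elim m)
      show ?case
      proof (intro allI impI)
        fix j assume "pulls b j \<omega> = m"
        moreover from this have "noise_sum (capped b m) j \<omega> = noise_sum b j \<omega>"
          by (intro noise_sum_capped) auto
        ultimately show "noise_sum b j \<omega> < e * m"
          using elim by (auto simp: not_le)
      qed
    qed
  qed
qed

lemma gaussian_noise_uminus: "gaussian_noise M F (\<lambda>j \<omega>. - X j \<omega>) s"
proof
  fix j
  show "distributed M lborel (\<lambda>\<omega>. - X j \<omega>) (normal_density 0 s)"
    using normal_density_affine[OF normal[of j] s_pos, of "-1" 0] s_pos by simp
  fix f :: "'a \<Rightarrow> real" assume "f \<in> borel_measurable (F j)"
  from indep_var_compose[OF indep_past[OF this], of id borel uminus borel]
  show "indep_var borel f borel (\<lambda>\<omega>. - X j \<omega>)" by (simp add: comp_def)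
qed (use s_pos adapted in auto)

lemma AE_noise_average_tendsto_0:
  assumes b: "\<And>i j. i \<le> j \<Longrightarrow> Measurable.pred (F j) (b i)"
  shows "AE \<omega> in M. filterlim (\<lambda>j. pulls b j \<omega>) at_top sequentially \<longrightarrow>
           (\<lambda>j. noise_sum b j \<omega> / pulls b j \<omega>) \<longlonglongrightarrow> 0"
proof -
  interpret neg: gaussian_noise M F "\<lambda>j \<omega>. - X j \<omega>" s
    by (rule gaussian_noise_uminus)
  have neg_sum: "neg.noise_sum b j \<omega> = - noise_sum b j \<omega>" for j \<omega>
    by (simp add: neg.noise_sum_def noise_sum_def sum_negf)
  have "AE \<omega> in M. \<forall>r. eventually (\<lambda>m. \<forall>j. pulls b j \<omega> = m \<longrightarrow> noise_sum b j \<omega> < 1 / Suc r * m) sequentially"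
    using b AE_noise_sum_less[where b = b and e = "1 / real (Suc r)" for r]
    by (subst AE_all_countable) (auto simp del: of_nat_Suc)
  moreover have "AE \<omega> in M. \<forall>r. eventually (\<lambda>m. \<forall>j. pulls b j \<omega> = m \<longrightarrow> - noise_sum b j \<omega> < 1 / Suc r * m) sequentially"
    using b neg.AE_noise_sum_less[where b = b and e = "1 / real (Suc r)" for r] unfolding neg_sum
    by (subst AE_all_countable) (auto simp del: of_nat_Suc)
  ultimately show ?thesis
  proof eventually_elim
    case (elim \<omega>)
    show ?case
    proof (intro impI LIMSEQ_I)
      fix r :: real assume lim: "filterlim (\<lambda>j. pulls b j \<omega>) at_top sequentially" and "r > 0"
      then obtain k where k: "1 / Suc k < r" using reals_Archimedean[of r] by (auto simp: inverse_eq_divide)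
      have "eventually (\<lambda>j. noise_sum b j \<omega> < 1 / Suc k * pulls b j \<omega>) sequentially"
        using filterlim_iff[THEN iffD1, OF lim, rule_format, OF elim(1)[rule_format, of k]]
        by eventually_elim auto
      moreover have "eventually (\<lambda>j. - noise_sum b j \<omega> < 1 / Suc k * pulls b j \<omega>) sequentially"
        using filterlim_iff[THEN iffD1, OF lim, rule_format, OF elim(2)[rule_format, of k]]
        by eventually_elim auto
      moreover have "eventually (\<lambda>j. pulls b j \<omega> > 0) sequentially"
        using lim by (auto simp: filterlim_at_top Suc_le_eq dest: spec[of _ 1])
      ultimately have "eventually (\<lambda>j. norm (noise_sum b j \<omega> / pulls b j \<omega> - 0) < r) sequentially"
      proof eventually_elim
        case (elim j)
        then have "\<bar>noise_sum b j \<omega>\<bar> < 1 / Suc k * pulls b j \<omega>" by linarith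
        with elim(3) have "\<bar>noise_sum b j \<omega>\<bar> / pulls b j \<omega> < 1 / Suc k"
          by (simp add: pos_divide_less_eq)
        with k show ?case by simp
      qed
      then show "\<exists>no. \<forall>n\<ge>no. norm (noise_sum b n \<omega> / pulls b n \<omega> - 0) < r"
        by (simp add: eventually_sequentially)
    qed
  qed
qed

end

definition (in prob_space) past :: "('i \<Rightarrow> 'a \<Rightarrow> real) \<Rightarrow> 'i set \<Rightarrow> 'a measure" where
  "past V A = vimage_algebra (space M) (\<lambda>\<omega>. \<lambda>x\<in>A. V x \<omega>) (PiM A (\<lambda>_. borel))"

lemma (in prob_space) past_component_measurable:
  assumes "x \<in> A"
  shows "V x \<in> borel_measurable (past V A)"
proof -
  have "(\<lambda>\<omega>. \<lambda>x\<in>A. V x \<omega>) \<in> measurable (past V A) (PiM A (\<lambda>_. borel))"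
    unfolding past_def by (rule measurable_vimage_algebra1) (auto simp: space_PiM)
  from measurable_compose[OF this measurable_component_singleton[OF assms]] assms
  show ?thesis by simp
qed

lemma (in prob_space) indep_var_past:
  fixes f g :: "'a \<Rightarrow> real"
  assumes V: "indep_vars (\<lambda>_. borel) V I" and AB: "A \<inter> B = {}" "A \<subseteq> I" "B \<subseteq> I"
    and f: "f \<in> borel_measurable (past V A)" and g: "g \<in> borel_measurable (past V B)"
  shows "indep_var borel f borel g"
proof -
  let ?R = "\<lambda>A \<omega>. \<lambda>x\<in>A. V x \<omega>"
  have ind: "indep_var (PiM A (\<lambda>_. borel)) (?R A) (PiM B (\<lambda>_. borel)) (?R B)"
    by (rule indep_var_restrict[OF V AB])
  have sets: "sets (past V A) = sigma_sets (space M) {?R A -` S \<inter> space M | S. S \<in> sets (PiM A (\<lambda>_. borel))}" for A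
    by (simp add: past_def sets_vimage_algebra)
  have sub: "sets (past V A) \<subseteq> sets M" "sets (past V B) \<subseteq> sets M"
    unfolding sets using indep_var_rv1[OF ind] indep_var_rv2[OF ind]
    by (intro sets.sigma_sets_subset; auto intro: measurable_sets)+
  have vimage: "h -` S \<inter> space M \<in> sets (past V A)"
    if "h \<in> borel_measurable (past V A)" "S \<in> sets borel" for h :: "'a \<Rightarrow> real" and S A
    using measurable_sets[OF that] by (simp add: past_def)
  have sigma: "sigma_sets (space M) {h -` S \<inter> space M | S. S \<in> sets borel} \<subseteq> sets (past V A)"
    if "h \<in> borel_measurable (past V A)" for h :: "'a \<Rightarrow> real" and A
    using vimage[OF that] sets.sigma_sets_subset[of "{h -` S \<inter> space M | S. S \<in> sets borel}" "past V A"]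
    by (auto simp: past_def)
  have "indep_set (sets (past V A)) (sets (past V B))"
    using ind unfolding indep_var_eq sets by blast
  then have "indep_set (sigma_sets (space M) {f -` S \<inter> space M | S. S \<in> sets borel})
      (sigma_sets (space M) {g -` S \<inter> space M | S. S \<in> sets borel})"
    unfolding indep_set_def
    by (rule indep_sets_mono_sets) (use sigma[OF f] sigma[OF g] in \<open>simp split: bool.split\<close>)
  moreover have "f \<in> borel_measurable M" "g \<in> borel_measurable M"
    using vimage[OF f] vimage[OF g] sub by (auto intro!: measurableI)
  ultimately show ?thesis
    unfolding indep_var_eq by blast
qed

lemma sum_lessThan_add:
  fixes f :: "nat \<Rightarrow> 'b :: comm_monoid_add"
  shows "sum f {..<a + b} = sum f {..<a} + (\<Sum>i<b. f (a + i))"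
  by (induction b) (auto simp: add.assoc)

lemma pulls_at_top:
  assumes "infinite {j. b j \<omega>}"
  shows "filterlim (\<lambda>j. pulls b j \<omega>) at_top sequentially"
proof -
  have "\<exists>j. C \<le> pulls b j \<omega>" for C
  proof (induction C)
    case (Suc C)
    then obtain j where j: "C \<le> pulls b j \<omega>" by blast
    obtain i where i: "i \<ge> j" "b i \<omega>"
      using assms by (auto simp: infinite_nat_iff_unbounded_le)
    have "Suc C \<le> pulls b (Suc i) \<omega>"
      using i j pulls_mono[OF i(1), of b \<omega>] by (simp add: pulls_def)
    then show ?case by blast
  qed simp
  then show ?thesis
    unfolding filterlim_at_top eventually_sequentially
    by (meson order_trans pulls_mono)
qed

subsection \<open>The experiment\<close>

text \<open>Participant \<open>i\<close> of step \<open>t\<close> is given the linear index \<open>j = t * n + i\<close>.\<close>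

locale thompson_sampling = prob_space M for M :: "'a measure" +
  fixes Y Z :: "nat \<Rightarrow> nat \<Rightarrow> nat \<Rightarrow> 'a \<Rightarrow> real"
    and n :: nat and mu :: "nat \<Rightarrow> real" and sy2 mp sp2 :: real
  assumes n_pos: "n \<ge> 1" and sy2_pos: "sy2 > 0" and sp2_pos: "sp2 > 0"
    and Y_normal: "\<And>t i k. i < n \<Longrightarrow> k < 2 \<Longrightarrow> distributed M lborel (Y t i k) (normal_density (mu k) (sqrt sy2))"
    and Z_normal: "\<And>t i k. i < n \<Longrightarrow> k < 2 \<Longrightarrow> distributed M lborel (Z t i k) std_normal_density"
    and indep: "indep_vars (\<lambda>_. borel)
           (\<lambda>j. case j of Inl (t, i, k) \<Rightarrow> Y t i k | Inr (t, i, k) \<Rightarrow> Z t i k)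
           (Inl ` ts_index n \<union> Inr ` ts_index n)"
begin

definition V :: "nat \<times> nat \<times> nat + nat \<times> nat \<times> nat \<Rightarrow> 'a \<Rightarrow> real" where
  "V j = (case j of Inl (t, i, k) \<Rightarrow> Y t i k | Inr (t, i, k) \<Rightarrow> Z t i k)"

definition reward :: "nat \<Rightarrow> nat \<Rightarrow> 'a \<Rightarrow> real" where
  "reward k j = Y (j div n) (j mod n) k"

definition pull :: "nat \<Rightarrow> nat \<Rightarrow> 'a \<Rightarrow> bool" where
  "pull k j \<omega> \<longleftrightarrow> ts_alloc n sy2 mp sp2 Y Z (j div n) (j mod n) \<omega> = (k = 1)"

definition reward_sum :: "nat \<Rightarrow> nat \<Rightarrow> 'a \<Rightarrow> real" where
  "reward_sum k j \<omega> = (\<Sum>i<j. of_bool (pull k i \<omega>) * reward k i \<omega>)"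

definition arm_mean :: "nat \<Rightarrow> nat \<Rightarrow> 'a \<Rightarrow> real" where
  "arm_mean k j \<omega> = post_mean sy2 mp sp2 (pulls (pull k) j \<omega>) (reward_sum k j \<omega>)"

definition arm_var :: "nat \<Rightarrow> nat \<Rightarrow> 'a \<Rightarrow> real" where
  "arm_var k j \<omega> = post_var sy2 sp2 (pulls (pull k) j \<omega>)"

lemma ts_stats_eq:
  "ts_stats n sy2 mp sp2 Y Z t \<omega> =
     (real (pulls (pull 0) (t * n) \<omega>), real (pulls (pull 1) (t * n) \<omega>), reward_sum 0 (t * n) \<omega>, reward_sum 1 (t * n) \<omega>)"
proof (induction t)
  case (Suc t)
  have card: "real (card {i. i < n \<and> A i}) = (\<Sum>i<n. of_bool (A i))" for A
  proof -
    have "(\<Sum>i<n. of_bool (A i) :: real) = (\<Sum>i\<in>{i. i < n \<and> A i}. 1)"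
      by (rule sum.mono_neutral_cong_right) auto
    then show ?thesis by simp
  qed
  have sum: "(\<Sum>i\<in>{i. i < n \<and> A i}. y i) = (\<Sum>i<n. of_bool (A i) * y i)" for A and y :: "nat \<Rightarrow> real"
    by (rule sum.mono_neutral_cong_left) auto
  have pull: "pull k (t * n + i) \<omega> \<longleftrightarrow> ts_alloc n sy2 mp sp2 Y Z t i \<omega> = (k = 1)"
    and rew: "reward k (t * n + i) = Y t i k" if "i < n" for i k
    using that by (auto simp: pull_def reward_def)
  have "Suc t * n = t * n + n" by simp
  then show ?case
    using Suc by (simp only: ts_stats.simps Let_def prod.case card sum pulls_def reward_sum_def sum_lessThan_add)
      (auto simp: pull rew ts_alloc_def)
qed (simp add: pulls_def reward_sum_def)

lemma ts_alloc_eq: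
  "ts_alloc n sy2 mp sp2 Y Z t i \<omega> \<longleftrightarrow>
     arm_mean 1 (t * n) \<omega> + sqrt (arm_var 1 (t * n) \<omega>) * Z t i 1 \<omega>
       > arm_mean 0 (t * n) \<omega> + sqrt (arm_var 0 (t * n) \<omega>) * Z t i 0 \<omega>"
  by (simp add: ts_alloc_def ts_choice_def ts_stats_eq arm_mean_def arm_var_def)

lemma pull_measurable:
  assumes "\<And>i k. i < j \<Longrightarrow> k < 2 \<Longrightarrow> reward k i \<in> borel_measurable N"
    and Z: "\<And>t i k. i < n \<Longrightarrow> k < 2 \<Longrightarrow> Z t i k \<in> borel_measurable N"
  shows "Measurable.pred N (pull k j)"
  using assms(1)
proof (induction j arbitrary: k rule: less_induct)
  case (less j)
  have le: "j div n * n \<le> j" by simp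
  have [measurable]: "i < j div n * n \<Longrightarrow> Measurable.pred N (pull k i)" for i k
    using less.prems less_le_trans[OF _ le] by (intro less.IH) (auto intro: less_trans)
  have [measurable]: "i < j div n * n \<Longrightarrow> reward 0 i \<in> borel_measurable N"
    "i < j div n * n \<Longrightarrow> reward 1 i \<in> borel_measurable N" for i
    using less.prems less_le_trans[OF _ le] by auto
  have [measurable]: "Z (j div n) (j mod n) 0 \<in> borel_measurable N"
    "Z (j div n) (j mod n) 1 \<in> borel_measurable N"
    using n_pos by (auto intro!: Z)
  have "pull k j = (\<lambda>\<omega>. (arm_mean 1 (j div n * n) \<omega> + sqrt (arm_var 1 (j div n * n) \<omega>) * Z (j div n) (j mod n) 1 \<omega>
      > arm_mean 0 (j div n * n) \<omega> + sqrt (arm_var 0 (j div n * n) \<omega>) * Z (j div n) (j mod n) 0 \<omega>) = (k = 1))"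
    by (rule ext) (simp only: pull_def ts_alloc_eq)
  also have "Measurable.pred N \<dots>"
    unfolding arm_mean_def arm_var_def post_mean_def post_var_def pulls_def reward_sum_def
    by measurable
  finally show ?case .
qed

text \<open>All sampling noise, future noise included, may be put into the history: the rewards are
  independent of it.\<close>

definition history :: "nat \<Rightarrow> 'a measure" where
  "history j = past V (Inl ` {(t, i, k) \<in> ts_index n. t * n + i < j} \<union> Inr ` ts_index n)"

lemma reward_history_measurable:
  assumes "i < j" "k < 2"
  shows "reward k i \<in> borel_measurable (history j)"
proof -
  have "V (Inl (i div n, i mod n, k)) \<in> borel_measurable (history j)"
    unfolding history_def
    by (rule past_component_measurable) (use assms n_pos in \<open>auto simp: ts_index_def\<close>)
  then show ?thesis by (simp add: V_def reward_def)
qed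

lemma pull_history_measurable:
  assumes "i \<le> j"
  shows "Measurable.pred (history j) (pull k i)"
proof (rule pull_measurable)
  show "Z t i k \<in> borel_measurable (history j)" if "i < n" "k < 2" for t i k
  proof -
    have "V (Inr (t, i, k)) \<in> borel_measurable (history j)"
      unfolding history_def
      by (rule past_component_measurable) (use that in \<open>auto simp: ts_index_def\<close>)
    then show ?thesis by (simp add: V_def)
  qed
qed (use assms in \<open>auto intro: reward_history_measurable\<close>)

lemma gaussian_noise_reward:
  assumes k: "k < 2"
  shows "gaussian_noise M history (\<lambda>j \<omega>. reward k j \<omega> - mu k) (sqrt sy2)"
proof
  show "sqrt sy2 > 0" using sy2_pos by simp
  fix j
  show "distributed M lborel (\<lambda>\<omega>. reward k j \<omega> - mu k) (normal_density 0 (sqrt sy2))"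
    using normal_density_affine[OF Y_normal[of "j mod n" k "j div n"], of 1 "- mu k"] k n_pos sy2_pos
    by (simp add: reward_def)
  show "(\<lambda>\<omega>. reward k i \<omega> - mu k) \<in> borel_measurable (history j)" if "i < j" for i
    using reward_history_measurable[OF that k] by measurable
  fix f :: "'a \<Rightarrow> real" assume f: "f \<in> borel_measurable (history j)"
  have "indep_var borel f borel (V (Inl (j div n, j mod n, k)))"
    by (rule indep_var_past[OF indep[folded V_def] _ _ _ f[unfolded history_def]
          past_component_measurable[OF singletonI]])
      (use n_pos k in \<open>auto simp: ts_index_def\<close>)
  from indep_var_compose[OF this, of id borel "\<lambda>x. x - mu k" borel]
  show "indep_var borel f borel (\<lambda>\<omega>. reward k j \<omega> - mu k)"
    by (simp add: comp_def V_def reward_def)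
qed

lemma AE_arm_mean_tendsto:
  assumes k: "k < 2"
  shows "AE \<omega> in M. infinite {j. pull k j \<omega>} \<longrightarrow> (\<lambda>j. arm_mean k j \<omega>) \<longlonglongrightarrow> mu k"
proof -
  interpret gaussian_noise M history "\<lambda>j \<omega>. reward k j \<omega> - mu k" "sqrt sy2"
    by (rule gaussian_noise_reward[OF k])
  have "AE \<omega> in M. filterlim (\<lambda>j. pulls (pull k) j \<omega>) at_top sequentially \<longrightarrow>
           (\<lambda>j. noise_sum (pull k) j \<omega> / pulls (pull k) j \<omega>) \<longlonglongrightarrow> 0"
    by (rule AE_noise_average_tendsto_0) (rule pull_history_measurable)
  then show ?thesis
  proof (eventually_elim, intro impI)
    fix \<omega> assume *: "filterlim (\<lambda>j. pulls (pull k) j \<omega>) at_top sequentially \<longrightarrow>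
           (\<lambda>j. noise_sum (pull k) j \<omega> / pulls (pull k) j \<omega>) \<longlonglongrightarrow> 0"
      and inf: "infinite {j. pull k j \<omega>}"
    let ?N = "\<lambda>j. real (pulls (pull k) j \<omega>)"
    have top: "filterlim (\<lambda>j. pulls (pull k) j \<omega>) at_top sequentially"
      by (rule pulls_at_top[of "pull k", OF inf])
    have inv: "(\<lambda>j. sy2 * c / ?N j) \<longlonglongrightarrow> 0" for c
      by (intro tendsto_divide_0[OF tendsto_const] filterlim_at_top_imp_at_infinity
          filterlim_compose[OF filterlim_real_sequentially top])
    have "(\<lambda>j. (sy2 * mp / ?N j + sp2 * (mu k + noise_sum (pull k) j \<omega> / ?N j)) / (sy2 * 1 / ?N j + sp2))
        \<longlonglongrightarrow> (0 + sp2 * (mu k + 0)) / (0 + sp2)"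
      using sp2_pos * top by (intro tendsto_intros inv) auto
    moreover have "eventually (\<lambda>j. (sy2 * mp / ?N j + sp2 * (mu k + noise_sum (pull k) j \<omega> / ?N j)) / (sy2 * 1 / ?N j + sp2)
        = arm_mean k j \<omega>) sequentially"
    proof -
      have "eventually (\<lambda>j. pulls (pull k) j \<omega> \<ge> 1) sequentially"
        using top by (auto simp: filterlim_at_top)
      then show ?thesis
      proof eventually_elim
        case (elim j)
        have "reward_sum k j \<omega> = mu k * ?N j + noise_sum (pull k) j \<omega>"
          unfolding reward_sum_def noise_sum_def pulls_def by (induction j) (auto simp: algebra_simps)
        moreover have "sy2 + ?N j * sp2 > 0" using sy2_pos sp2_pos by (simp add: add_pos_nonneg)
        ultimately show ?case
          using elim sy2_pos sp2_pos by (simp add: arm_mean_def post_mean_def divide_simps) (simp add: algebra_simps)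
      qed
    qed
    ultimately show "(\<lambda>j. arm_mean k j \<omega>) \<longlonglongrightarrow> mu k"
      using sp2_pos by (auto intro: Lim_transform_eventually)
  qed
qed

lemma AE_infinite_large_noise:
  assumes k: "k < 2" "k' < 2" "k \<noteq> k'"
  shows "AE \<omega> in M. infinite {t. Z t 0 k \<omega> > c \<and> Z t 0 k' \<omega> < 0}"
proof (rule AE_infinite_indep_events)
  let ?K = "\<lambda>t. {Inr (t, 0, k), Inr (t, 0, k')}"
  let ?D = "density lborel std_normal_density"
  interpret D: prob_space ?D
    by (rule prob_space_normal_density) simp
  have "indep_vars (\<lambda>t. PiM (?K t) (\<lambda>_. borel)) (\<lambda>t \<omega>. \<lambda>x\<in>?K t. V x \<omega>) UNIV"
    by (rule indep_vars_restrict[OF indep[folded V_def]])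
      (use n_pos k in \<open>auto simp: ts_index_def disjoint_family_on_def\<close>)
  then have "indep_events (\<lambda>t. {\<omega> \<in> space M. (\<lambda>g. g (Inr (t, 0, k)) > c \<and> g (Inr (t, 0, k')) < 0) (\<lambda>x\<in>?K t. V x \<omega>)}) UNIV"
    by (rule indep_eventsI_indep_vars) measurable
  then show "indep_events (\<lambda>t. {\<omega> \<in> space M. Z t 0 k \<omega> > c \<and> Z t 0 k' \<omega> < 0}) UNIV"
    by (simp add: V_def)
  have pos: "measure ?D A > 0" if "A \<in> sets borel" "emeasure lborel A > 0" for A
    using emeasure_normal_density_pos[OF _ that, of 1 0] by (simp add: D.emeasure_eq_measure)
  have "emeasure lborel {c<..} \<ge> emeasure lborel {c<..<c+1}"
    by (rule emeasure_mono) auto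
  moreover have "emeasure lborel {..<0::real} \<ge> emeasure lborel {-1<..<0::real}"
    by (rule emeasure_mono) auto
  ultimately show "0 < measure ?D {c<..} * measure ?D {..<0}"
    by (intro mult_pos_pos pos) (auto intro: less_le_trans[rotated])
  fix t
  have "indep_var borel (V (Inr (t, 0, k'))) borel (V (Inr (t, 0, k)))"
    by (rule indep_var_past[OF indep[folded V_def] _ _ _
          past_component_measurable[OF singletonI] past_component_measurable[OF singletonI]])
      (use n_pos k in \<open>auto simp: ts_index_def\<close>)
  from indep_varD[OF this, of "{..<0}" "{c<..}"]
  have "prob {\<omega> \<in> space M. Z t 0 k \<omega> > c \<and> Z t 0 k' \<omega> < 0}
      = prob (Z t 0 k' -` {..<0} \<inter> space M) * prob (Z t 0 k -` {c<..} \<inter> space M)"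
    by (simp add: V_def vimage_def Int_def conj_commute conj_ac)
  moreover have "prob (Z t 0 l -` A \<inter> space M) = measure ?D A" if "l < 2" "A \<in> sets borel" for l A
    using distributed_distr_eq_density[OF Z_normal[of 0 l t]] n_pos that
      measure_distr[OF distributed_measurable[OF Z_normal[of 0 l t]], of A] by simp
  ultimately show "measure ?D {c<..} * measure ?D {..<0}
      \<le> prob {\<omega> \<in> space M. Z t 0 k \<omega> > c \<and> Z t 0 k' \<omega> < 0}"
    using k by simp
qed

lemma finite_pulls_imp_constant:
  assumes "finite {j. pull k j \<omega>}"
  shows "\<exists>j0. \<forall>j\<ge>j0. \<not> pull k j \<omega> \<and> arm_mean k j \<omega> = arm_mean k j0 \<omega> \<and> arm_var k j \<omega> = arm_var k j0 \<omega>"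
proof -
  obtain j0 where j0: "\<And>j. j \<ge> j0 \<Longrightarrow> \<not> pull k j \<omega>"
    using assms by (auto simp: finite_nat_iff_bounded subset_eq) (meson not_le)
  have "pulls (pull k) j \<omega> = pulls (pull k) j0 \<omega> \<and> reward_sum k j \<omega> = reward_sum k j0 \<omega>" if "j \<ge> j0" for j
    using that by (induction j rule: dec_induct) (auto simp: pulls_def reward_sum_def j0)
  with j0 show ?thesis unfolding arm_mean_def arm_var_def by (intro exI[of _ j0]) metis
qed

lemma pull_if_sample_greater:
  assumes "k < 2" "k' < 2" "k \<noteq> k'"
    and "arm_mean k' (t * n) \<omega> + sqrt (arm_var k' (t * n) \<omega>) * Z t 0 k' \<omega>
       < arm_mean k (t * n) \<omega> + sqrt (arm_var k (t * n) \<omega>) * Z t 0 k \<omega>"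
  shows "pull k (t * n) \<omega>"
proof -
  have "k = 0 \<and> k' = 1 \<or> k = 1 \<and> k' = 0" using assms(1-3) by auto
  then show ?thesis
    using assms(4) n_pos by (auto simp: pull_def ts_alloc_eq)
qed

lemma arm_var_pos: "arm_var k j \<omega> > 0"
  using sy2_pos sp2_pos by (simp add: arm_var_def post_var_def add_pos_nonneg)

lemma infinite_pulls:
  assumes k: "k < 2" "k' < 2" "k \<noteq> k'"
    and noise: "\<And>c :: nat. infinite {t. Z t 0 k \<omega> > c \<and> Z t 0 k' \<omega> < 0}"
    and mean: "infinite {j. pull k' j \<omega>} \<longrightarrow> (\<lambda>j. arm_mean k' j \<omega>) \<longlonglongrightarrow> mu k'"
  shows "infinite {j. pull k j \<omega>}"
proof
  assume "finite {j. pull k j \<omega>}"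
  then obtain j0 where j0: "\<And>j. j \<ge> j0 \<Longrightarrow> \<not> pull k j \<omega>"
    "\<And>j. j \<ge> j0 \<Longrightarrow> arm_mean k j \<omega> = arm_mean k j0 \<omega>" "\<And>j. j \<ge> j0 \<Longrightarrow> arm_var k j \<omega> = arm_var k j0 \<omega>"
    using finite_pulls_imp_constant by blast
  have "convergent (\<lambda>j. arm_mean k' j \<omega>)"
  proof (cases "finite {j. pull k' j \<omega>}")
    case True
    then obtain j1 where "\<And>j. j \<ge> j1 \<Longrightarrow> arm_mean k' j \<omega> = arm_mean k' j1 \<omega>"
      using finite_pulls_imp_constant by blast
    then have "eventually (\<lambda>j. arm_mean k' j \<omega> = arm_mean k' j1 \<omega>) sequentially"
      unfolding eventually_sequentially by blast
    then have "(\<lambda>j. arm_mean k' j \<omega>) \<longlonglongrightarrow> arm_mean k' j1 \<omega>"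
      by (rule tendsto_eventually)
    then show ?thesis by (rule convergentI)
  qed (use mean in \<open>auto intro: convergentI\<close>)
  then have "Bseq (\<lambda>j. arm_mean k' j \<omega>)"
    by (rule convergent_imp_Bseq)
  then obtain B where B: "\<And>j. \<bar>arm_mean k' j \<omega>\<bar> \<le> B"
    by (auto simp: Bseq_def)
  let ?s = "sqrt (arm_var k j0 \<omega>)"
  have s: "?s > 0" by (simp add: arm_var_pos)
  obtain c :: nat where c: "(B - arm_mean k j0 \<omega>) / ?s \<le> c"
    using real_arch_simple by blast
  obtain t where t: "t \<ge> j0" "Z t 0 k \<omega> > c" "Z t 0 k' \<omega> < 0"
    using noise[of c] by (auto simp: infinite_nat_iff_unbounded_le)
  have tn: "t * n \<ge> j0"
    using t(1) n_pos by (metis le_trans mult.right_neutral mult_le_mono2)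
  have "arm_mean k' (t * n) \<omega> + sqrt (arm_var k' (t * n) \<omega>) * Z t 0 k' \<omega> \<le> B"
    using B[of "t * n"] t(3) arm_var_pos[of k' "t * n" \<omega>]
    by (smt (verit) mult_pos_neg real_sqrt_gt_zero)
  also have "B \<le> arm_mean k j0 \<omega> + ?s * c"
    using c s by (simp add: pos_divide_le_eq algebra_simps)
  also have "\<dots> < arm_mean k j0 \<omega> + ?s * Z t 0 k \<omega>"
    using t(2) s by simp
  finally have "pull k (t * n) \<omega>"
    using j0(2,3)[OF tn] by (intro pull_if_sample_greater[OF k]) simp
  with j0(1)[OF tn] show False by simp
qed

lemma AE_AP_TS_at_top:
  assumes "mu 1 > mu 0"
  shows "AE \<omega> in M. filterlim (\<lambda>T. AP_TS n sy2 mp sp2 Y Z T \<omega>) at_top sequentially"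
proof -
  have noise: "AE \<omega> in M. \<forall>c::nat. infinite {t. Z t 0 k \<omega> > c \<and> Z t 0 k' \<omega> < 0}" if "k < 2" "k' < 2" "k \<noteq> k'" for k k'
    using AE_infinite_large_noise[OF that] by (subst AE_all_countable) auto
  have "AE \<omega> in M. \<forall>c::nat. infinite {t. Z t 0 0 \<omega> > c \<and> Z t 0 1 \<omega> < 0}" by (rule noise) auto
  moreover have "AE \<omega> in M. \<forall>c::nat. infinite {t. Z t 0 1 \<omega> > c \<and> Z t 0 0 \<omega> < 0}" by (rule noise) auto
  moreover have "AE \<omega> in M. infinite {j. pull 0 j \<omega>} \<longrightarrow> (\<lambda>j. arm_mean 0 j \<omega>) \<longlonglongrightarrow> mu 0"
    by (rule AE_arm_mean_tendsto) simp
  moreover have "AE \<omega> in M. infinite {j. pull 1 j \<omega>} \<longrightarrow> (\<lambda>j. arm_mean 1 j \<omega>) \<longlonglongrightarrow> mu 1"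
    by (rule AE_arm_mean_tendsto) simp
  ultimately show ?thesis
  proof eventually_elim
    case (elim \<omega>)
    have "infinite {j. pull 0 j \<omega>}" "infinite {j. pull 1 j \<omega>}"
      using infinite_pulls[of 0 1 \<omega>] infinite_pulls[of 1 0 \<omega>] elim by auto
    then have "(\<lambda>j. arm_mean 1 j \<omega> - arm_mean 0 j \<omega>) \<longlonglongrightarrow> mu 1 - mu 0"
      using elim by (intro tendsto_diff) auto
    then have "eventually (\<lambda>j. arm_mean 1 j \<omega> - arm_mean 0 j \<omega> > 0) sequentially"
      using assms by (intro order_tendstoD) auto
    then obtain j0 where j0: "\<And>j. j \<ge> j0 \<Longrightarrow> arm_mean 1 j \<omega> - arm_mean 0 j \<omega> > 0"
      by (auto simp: eventually_sequentially)
    have pi: "pi_TS n sy2 mp sp2 Y Z t \<omega> > 1/2" if "t \<ge> j0" for t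
    proof -
      have "t * n \<ge> j0"
        using that n_pos by (metis le_trans mult.right_neutral mult_le_mono2)
      then have "mu_D n sy2 mp sp2 Y Z t \<omega> > 0"
        using j0 by (simp add: mu_D_def ts_stats_eq arm_mean_def)
      moreover have "sigma2_D n sy2 mp sp2 Y Z t \<omega> > 0"
        using arm_var_pos[of 0 "t * n" \<omega>] arm_var_pos[of 1 "t * n" \<omega>]
        by (simp add: sigma2_D_def ts_stats_eq arm_var_def)
      ultimately show ?thesis
        unfolding pi_TS_def by (intro Phi_gt_half) simp
    qed
    show ?case
      unfolding filterlim_at_top eventually_sequentially
    proof (intro allI exI impI)
      fix C T assume T: "T \<ge> j0 + C"
      have "C = card {j0 + 1..j0 + C}" by simp
      also have "\<dots> \<le> AP_TS n sy2 mp sp2 Y Z T \<omega>"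
        unfolding AP_TS_def using T pi by (intro card_mono) auto
      finally show "C \<le> AP_TS n sy2 mp sp2 Y Z T \<omega>" .
    qed
  qed
qed

end

theorem theorem3p1:
  fixes M :: "'a measure"
    and Y Z :: "nat \<Rightarrow> nat \<Rightarrow> nat \<Rightarrow> 'a \<Rightarrow> real"
    and n :: nat and mu0 mu1 sy2 mp sp2 :: real
  assumes "prob_space M"
    and "n \<ge> 1" and "sy2 > 0" and "sp2 > 0"
    and "\<And>t i k. i < n \<Longrightarrow> k < 2 \<Longrightarrow>
           distributed M lborel (Y t i k) (normal_density (if k = 0 then mu0 else mu1) (sqrt sy2))"
    and "\<And>t i k. i < n \<Longrightarrow> k < 2 \<Longrightarrow> distributed M lborel (Z t i k) std_normal_density"
    and "prob_space.indep_vars M (\<lambda>_. borel)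
           (\<lambda>j. case j of Inl (t, i, k) \<Rightarrow> Y t i k | Inr (t, i, k) \<Rightarrow> Z t i k)
           (Inl ` ts_index n \<union> Inr ` ts_index n)"
    and "mu1 > mu0"
  shows "AE \<omega> in M. filterlim (\<lambda>T. AP_TS n sy2 mp sp2 Y Z T \<omega>) at_top sequentially"
proof -
  interpret prob_space M by fact
  interpret thompson_sampling M Y Z n "\<lambda>k. if k = 0 then mu0 else mu1" sy2 mp sp2
    by (intro thompson_sampling.intro thompson_sampling_axioms.intro assms)
  show ?thesis
    by (rule AE_AP_TS_at_top) (use assms in simp)
qed

end
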